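(* Let $K$ be a $k$-dimensional USO and $h\in[k]$. Performing a partial swap on $K$ in dimension $h$ does not change the set of $h$-phases; that is, if $K'$ is the USO obtained from $K$ by the partial swap in dimension $h$, then the $h$-phases of $K'$ and the $h$-phases of $K$ are the same sets of $h$-edges of $Q_k$.
   Context: $[k]=\{1,\ldots,k\}$. $Q_k$ is the $k$-dimensional hypercube graph with vertex set $\{0,1\}^k$; $v\oplus i$ denotes the neighbor of $v$ differing from $v$ exactly in coordinate $i$, and $\{v,v\oplus i\}$ is called an $i$-edge. An orientation $O$ of $Q_k$ directs every edge; it is identified with the function $O:\{0,1\}^k\to\{0,1\}^k$ where $O(v)_i=1$ if the edge $\{v,v\oplus i\}$ is directed upwards (from its endpoint with $i$-th coordinate $0$ to its endpoint with $i$-th coordinate $1$) and $O(v)_i=0$ if it is directed downwards (so $O(v)_i=O(v\oplus i)_i$). A face is the subgraph induced by all vertices that agree with a fixed string $f\in\{0,1,*\}^k$ on the non-$*$ positions. $O$ is a Unique Sink Orientation (USO) if every face contains exactly one vertex with no outgoing edges inside that face. Phases. Flipping a set of edges means reversing their directions. The $i$-phases of a USO $O$ are the minimal equivalence classes of the set of $i$-edges such that flipping any collection of these classes preserves the USO property; equivalently (by a known result of Schurr) they are the blocks of the unique partition of the set of (undirected) $i$-edges such that, for every set $P$ of $i$-edges, flipping $P$ in $O$ gives a USO if and only if $P$ is a union of blocks. Partial swap. For a USO $K$ of $Q_k$ and $h\in[k]$, the partial swap of $K$ in dimension $h$ is the orientation $K'$ with $K'(v)=K(v\oplus h)$ if $K(v)_h=1$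 (the $h$-edge at $v$ is upwards) and $K'(v)=K(v)$ otherwise. It is known that $K'$ is a USO. *)

theory Defs
  imports Main "HOL-Library.Disjoint_Sets"
begin

section \<open>Orientations of the hypercube\<close>

(* The cube Q_k is indexed by a finite type 'n with CARD('n) = k; [k] is the type 'n itself,
   and the bits 0, 1 are False, True. *)

type_synonym 'n vertex = "'n \<Rightarrow> bool"

(* A v i holds iff the i-edge at v points from its endpoint with i-th coordinate 0
   to its endpoint with i-th coordinate 1.  This is not the outmap of A. *)
type_synonym 'n orientation = "'n vertex \<Rightarrow> 'n \<Rightarrow> bool"

definition nbr :: "'n vertex \<Rightarrow> 'n \<Rightarrow> 'n vertex" where
  "nbr v i = v(i := \<not> v i)"

definition edges :: "'n \<Rightarrow> 'n vertex set set" where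
  "edges i = {{v, nbr v i} | v. True}"

definition is_orientation :: "'n orientation \<Rightarrow> bool" where
  "is_orientation A \<longleftrightarrow> (\<forall>v i. A (nbr v i) i = A v i)"

(* upward edges leave their 0-endpoint, downward edges leave their 1-endpoint *)
definition outgoing :: "'n orientation \<Rightarrow> 'n vertex \<Rightarrow> 'n \<Rightarrow> bool" where
  "outgoing A v i \<longleftrightarrow> (if v i then \<not> A v i else A v i)"

(* f encodes a string over 0, 1, *, with None for * *)
definition face :: "('n \<Rightarrow> bool option) \<Rightarrow> 'n vertex set" where
  "face f = {v. \<forall>i b. f i = Some b \<longrightarrow> v i = b}"

definition is_face_sink :: "'n orientation \<Rightarrow> ('n \<Rightarrow> bool option) \<Rightarrow> 'n vertex \<Rightarrow> bool" where
  "is_face_sink A f v \<longleftrightarrow> v \<in> face f \<and> (\<forall>i. f i = None \<longrightarrow> \<not> outgoing A v i)"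

definition uso :: "'n orientation \<Rightarrow> bool" where
  "uso A \<longleftrightarrow> is_orientation A \<and> (\<forall>f. \<exists>!v. is_face_sink A f v)"


section \<open>Phases and partial swaps\<close>

definition flip :: "'n orientation \<Rightarrow> 'n vertex set set \<Rightarrow> 'n orientation" where
  "flip A P = (\<lambda>v i. if {v, nbr v i} \<in> P then \<not> A v i else A v i)"

definition flippable_partition :: "'n orientation \<Rightarrow> 'n \<Rightarrow> 'n vertex set set set \<Rightarrow> bool" where
  "flippable_partition A i PP \<longleftrightarrow>
     partition_on (edges i) PP \<and> (\<forall>C \<subseteq> PP. uso (flip A (\<Union>C)))"

definition phase_partition :: "'n orientation \<Rightarrow> 'n \<Rightarrow> 'n vertex set set set \<Rightarrow> bool" where
  "phase_partition A i PP \<longleftrightarrow>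
     flippable_partition A i PP \<and>
     (\<forall>QQ. flippable_partition A i QQ \<longrightarrow> refines (edges i) PP QQ)"

(* well-defined for every USO on a finite cube: see phase_partition_ex1 below *)
definition phases :: "'n orientation \<Rightarrow> 'n \<Rightarrow> 'n vertex set set set" where
  "phases A i = (THE PP. phase_partition A i PP)"

definition partial_swap :: "'n orientation \<Rightarrow> 'n \<Rightarrow> 'n orientation" where
  "partial_swap A h = (\<lambda>v. if A v h then A (nbr v h) else A v)"


section \<open>The Szabo-Welzl condition\<close>

lemma nbr_simps [simp]:
  "nbr v i i = (\<not> v i)" "j \<noteq> i \<Longrightarrow> nbr v i j = v j" "nbr (nbr v i) i = v"
  by (auto simp: nbr_def)

lemma orientation_nbr: "is_orientation A \<Longrightarrow> A (nbr v i) i = A v i"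
  by (simp add: is_orientation_def)

lemma outgoing_iff: "outgoing A v i \<longleftrightarrow> A v i \<noteq> v i"
  by (auto simp: outgoing_def)

lemma nbr_edge_eq: "{nbr v i, v} = {v, nbr v i}"
  by auto

lemma uso_orientation: "uso A \<Longrightarrow> is_orientation A"
  by (simp add: uso_def)

lemma uso_flip_direction:
  assumes "uso A"
  shows "uso (\<lambda>v i. A v i \<noteq> (i = j))"
proof -
  let ?B = "\<lambda>v i. A v i \<noteq> (i = j)"
  have orA: "is_orientation A" using assms by (rule uso_orientation)
  have orB: "is_orientation ?B" using orA by (simp add: is_orientation_def)
  have A1: "\<exists>!v. is_face_sink A f v" for f
    using assms by (simp add: uso_def)
  have "\<exists>!v. is_face_sink ?B f v" for f
  proof (cases "f j")
    case (Some b)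
    then have "i \<noteq> j" if "f i = None" for i
      using that by auto
    then have "is_face_sink ?B f v = is_face_sink A f v" for v
      by (simp add: is_face_sink_def outgoing_iff)
    then show ?thesis using A1[of f] by simp
  next
    case None
    define F where "F b = f(j := Some b)" for b
    define s where "s b = (THE v. is_face_sink A (F b) v)" for b
    have s: "is_face_sink A (F b) (s b)" for b
      unfolding s_def by (rule theI'[OF A1])
    have s_unique: "v = s b" if "is_face_sink A (F b) v" for b v
      using that s[of b] A1[of "F b"] by blast
    have split: "is_face_sink A (F b) v \<longleftrightarrow>
        v j = b \<and> v \<in> face f \<and> (\<forall>i. f i = None \<and> i \<noteq> j \<longrightarrow> A v i = v i)" for b v
      using None unfolding is_face_sink_def outgoing_iff face_def F_def by auto
    have sinkA: "is_face_sink A f v \<longleftrightarrow> (\<exists>b. v = s b) \<and> A v j = v j" for v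
    proof
      assume *: "is_face_sink A f v"
      have "is_face_sink A (F (v j)) v" "A v j = v j"
        using * None unfolding split by (auto simp: is_face_sink_def outgoing_iff)
      then show "(\<exists>b. v = s b) \<and> A v j = v j" using s_unique by blast
    next
      assume *: "(\<exists>b. v = s b) \<and> A v j = v j"
      then obtain b where "v = s b" by blast
      then have "v \<in> face f" "\<forall>i. f i = None \<and> i \<noteq> j \<longrightarrow> A v i = v i"
        using s[of b] unfolding split by simp_all
      then show "is_face_sink A f v"
        using conjunct2[OF *] unfolding is_face_sink_def outgoing_iff by metis
    qed
    have sinkB: "is_face_sink ?B f v \<longleftrightarrow> (\<exists>b. v = s b) \<and> A v j \<noteq> v j" for v
    proof
      assume *: "is_face_sink ?B f v"
      then have "?B v j = v j" using None by (auto simp: is_face_sink_def outgoing_iff)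
      moreover have "is_face_sink A (F (v j)) v"
        using * unfolding split by (auto simp: is_face_sink_def outgoing_iff)
      ultimately show "(\<exists>b. v = s b) \<and> A v j \<noteq> v j" using s_unique by auto
    next
      assume *: "(\<exists>b. v = s b) \<and> A v j \<noteq> v j"
      then obtain b where "v = s b" by blast
      then have "v \<in> face f" "\<forall>i. f i = None \<and> i \<noteq> j \<longrightarrow> A v i = v i"
        using s[of b] unfolding split by simp_all
      then show "is_face_sink ?B f v"
        using conjunct2[OF *] unfolding is_face_sink_def outgoing_iff by metis
    qed
    have sj: "s b j = b" for b using s[of b] by (simp add: split)
    obtain w where "is_face_sink A f w" and w: "\<And>v. is_face_sink A f v \<Longrightarrow> v = w"
      using A1[of f] by blast
    then obtain b where "w = s b" "A w j = w j" using sinkA by blast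
    then have b: "w = s b" "A (s b) j = b" using sj by simp_all
    have "A (s (\<not> b)) j \<noteq> (\<not> b)"
    proof
      assume "A (s (\<not> b)) j = (\<not> b)"
      then have "is_face_sink A f (s (\<not> b))" unfolding sinkA using sj by metis
      then have "s (\<not> b) = s b" using w b by simp
      then show False using sj[of b] sj[of "\<not> b"] by simp
    qed
    then have "is_face_sink ?B f (s (\<not> b))" unfolding sinkB using sj by metis
    moreover have "v = s (\<not> b)" if sB: "is_face_sink ?B f v" for v
    proof -
      obtain c where c: "v = s c" "A v j \<noteq> v j" using sB unfolding sinkB by blast
      then have "A (s c) j \<noteq> c" using sj[of c] by simp
      then have "c \<noteq> b" using b(2) by blast
      then have "c = (\<not> b)" by (cases b) simp_all
      with c show ?thesis by simp
    qed
    ultimately show ?thesis by blast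
  qed
  with orB show ?thesis by (simp add: uso_def)
qed

lemma uso_flip_directions:
  assumes "uso A" "finite J"
  shows "uso (\<lambda>v i. A v i \<noteq> (i \<in> J))"
  using assms(2)
proof induction
  case empty
  then show ?case using assms(1) by simp
next
  case (insert j J)
  have eq: "(\<lambda>v i. (A v i \<noteq> (i \<in> J)) \<noteq> (i = j)) = (\<lambda>v i. A v i \<noteq> (i \<in> insert j J))"
    using insert.hyps by (intro ext) auto
  show ?case using uso_flip_direction[OF insert.IH, of j] unfolding eq .
qed

(* Szabo and Welzl's outmap condition; for u i \<noteq> v i, outmaps differ in i iff A u i = A v i *)
lemma uso_iff:
  fixes A :: "'n::finite orientation"
  shows "uso A \<longleftrightarrow> is_orientation A \<and> (\<forall>u v. u \<noteq> v \<longrightarrow> (\<exists>i. u i \<noteq> v i \<and> A u i = A v i))"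
    (is "_ \<longleftrightarrow> _ \<and> ?SW")
proof (intro iffI conjI)
  assume "uso A"
  then show "is_orientation A" by (rule uso_orientation)
  show ?SW
  proof (intro allI impI, rule ccontr)
    fix u v :: "'n vertex"
    assume "u \<noteq> v" and no: "\<not> (\<exists>i. u i \<noteq> v i \<and> A u i = A v i)"
    define J where "J = {i. A u i \<noteq> u i}"
    define f where "f i = (if u i = v i then Some (u i) else None)" for i
    let ?B = "\<lambda>v i. A v i \<noteq> (i \<in> J)"
    have "uso ?B" using uso_flip_directions[OF \<open>uso A\<close>, of J] by simp
    moreover have "is_face_sink ?B f u" "is_face_sink ?B f v"
      using no unfolding is_face_sink_def outgoing_iff face_def f_def J_def
      by (auto split: if_splits)
    ultimately show False using \<open>u \<noteq> v\<close> unfolding uso_def by blast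
  qed
next
  assume *: "is_orientation A \<and> ?SW"
  have "\<exists>!v. is_face_sink A f v" for f
  proof (rule ex_ex1I)
    define g where "g v = (\<lambda>i. case f i of Some b \<Rightarrow> b | None \<Rightarrow> A v i \<noteq> v i)" for v
    have "g ` face f \<subseteq> face f" by (auto simp: g_def face_def)
    moreover have "inj_on g (face f)"
    proof (rule inj_onI, rule ccontr)
      fix u v assume uv: "u \<in> face f" "v \<in> face f" "g u = g v" "u \<noteq> v"
      then obtain i where i: "u i \<noteq> v i" "A u i = A v i" using * by blast
      then have "f i = None" using uv by (cases "f i") (auto simp: face_def)
      then show False using i fun_cong[OF \<open>g u = g v\<close>, of i] by (auto simp: g_def)
    qed
    ultimately have "g ` face f = face f" by (intro endo_inj_surj) simp_all
    moreover have "(\<lambda>i. case f i of Some b \<Rightarrow> b | None \<Rightarrow> False) \<in> face f"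
      by (auto simp: face_def)
    ultimately obtain v where v: "v \<in> face f"
      "g v = (\<lambda>i. case f i of Some b \<Rightarrow> b | None \<Rightarrow> False)"
      by (metis (no_types, lifting) imageE)
    have "A v i = v i" if "f i = None" for i
      using fun_cong[OF v(2), of i] that by (simp add: g_def)
    then show "\<exists>v. is_face_sink A f v" using v(1) by (auto simp: is_face_sink_def outgoing_iff)
  next
    fix u v assume sinks: "is_face_sink A f u" "is_face_sink A f v"
    show "u = v"
    proof (rule ccontr)
      assume "u \<noteq> v"
      then obtain i where i: "u i \<noteq> v i" "A u i = A v i" using * by blast
      then show False using sinks
        by (cases "f i") (auto simp: is_face_sink_def outgoing_iff face_def)
    qed
  qed
  then show "uso A" using * by (simp add: uso_def)
qed


section \<open>Partial swaps preserve USOs\<close>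

lemma uso_partial_swap:
  fixes A :: "'n::finite orientation"
  assumes "uso A"
  shows "uso (partial_swap A h)"
proof -
  have orA: "is_orientation A" and SW: "\<And>u v. u \<noteq> v \<Longrightarrow> \<exists>i. u i \<noteq> v i \<and> A u i = A v i"
    using assms by (auto simp: uso_iff)
  let ?B = "partial_swap A h"
  have Bh: "?B v h = A v h" for v
    using orientation_nbr[OF orA, of v h] by (simp add: partial_swap_def)
  have comm: "nbr (nbr v i) h = nbr (nbr v h) i" for v :: "'n vertex" and i
    by (cases "i = h") (auto simp: nbr_def fun_eq_iff)
  define p where "p v = (if A v h then nbr v h else v)" for v
  have B: "?B v = A (p v)" for v by (simp add: partial_swap_def p_def)
  have ph: "A (p v) h = A v h" for v
    using orientation_nbr[OF orA, of v h] by (simp add: p_def)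
  have pj: "p v j = v j" if "j \<noteq> h" for v j using that by (simp add: p_def)
  have SWB: "\<exists>i. u i \<noteq> v i \<and> ?B u i = ?B v i" if "u \<noteq> v" for u v
  proof (cases "u h \<noteq> v h \<and> A u h = A v h")
    case True
    then show ?thesis using Bh by metis
  next
    case False
    have "p u \<noteq> p v"
      using that False ph[of u] ph[of v] by (metis nbr_simps(3) p_def)
    then obtain i where i: "p u i \<noteq> p v i" "A (p u) i = A (p v) i" using SW by blast
    show ?thesis
    proof (cases "i = h")
      case True
      then have "A u h = A v h" using i ph by simp
      then have "u h \<noteq> v h" using i(1) True by (auto simp: p_def split: if_splits)
      then show ?thesis using False \<open>A u h = A v h\<close> by simp
    next
      case False
      then show ?thesis using i pj B by metis
    qed
  qed
  have "?B (nbr v i) i = ?B v i" for v i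
  proof (cases "i = h")
    case True
    then show ?thesis using Bh orientation_nbr[OF orA] by metis
  next
    case False
    have *: "A (nbr (nbr v h) i) i = A (nbr v h) i" "A (nbr v i) i = A v i"
      by (rule orientation_nbr[OF orA])+
    show ?thesis
    proof (cases "A (nbr v i) h = A v h")
      case True
      then show ?thesis using * comm[of v i] by (auto simp: partial_swap_def)
    next
      case neq: False
      have "nbr v h \<noteq> nbr v i" using False by (metis nbr_simps(1,2))
      then obtain j where j: "nbr v h j \<noteq> nbr v i j" "A (nbr v h) j = A (nbr v i) j"
        using SW by blast
      have "j \<noteq> h" using j neq orientation_nbr[OF orA, of v h] by auto
      then have "j = i" using j by (cases "j = i") auto
      then show ?thesis using j * comm[of v i] by (auto simp: partial_swap_def)
    qed
  qed
  then show ?thesis using SWB by (auto simp: uso_iff is_orientation_def)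
qed


section \<open>Phases are well-defined\<close>

definition in_direct_phase :: "'n orientation \<Rightarrow> 'n \<Rightarrow> 'n vertex \<Rightarrow> 'n vertex \<Rightarrow> bool" where
  "in_direct_phase A i u v \<longleftrightarrow> u i \<noteq> v i \<and> (\<forall>j. j \<noteq> i \<and> u j \<noteq> v j \<longrightarrow> A u j \<noteq> A v j)"

lemma edge_in_edges: "{v, nbr v i} \<in> edges i"
  by (auto simp: edges_def)

lemma edge_notin_edges:
  assumes "j \<noteq> i"
  shows "{v, nbr v j} \<notin> edges i"
proof
  assume "{v, nbr v j} \<in> edges i"
  then obtain w where "{v, nbr v j} = {w, nbr w i}" by (auto simp: edges_def)
  then have "nbr v j = nbr v i"
    by (auto simp: doubleton_eq_iff)
  then show False using assms by (metis nbr_simps(1,2))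
qed

lemma uso_flip_iff:
  fixes A :: "'n::finite orientation"
  assumes "uso A" and P: "P \<subseteq> edges i"
  shows "uso (flip A P) \<longleftrightarrow>
    (\<forall>u v. in_direct_phase A i u v \<longrightarrow> ({u, nbr u i} \<in> P \<longleftrightarrow> {v, nbr v i} \<in> P))"
proof -
  have orA: "is_orientation A" and SW: "\<And>u v. u \<noteq> v \<Longrightarrow> \<exists>i. u i \<noteq> v i \<and> A u i = A v i"
    using assms(1) by (auto simp: uso_iff)
  have other: "flip A P v j = A v j" if "j \<noteq> i" for v j
    using edge_notin_edges[OF that, of v] P by (auto simp: flip_def)
  have same: "flip A P v i \<longleftrightarrow> (A v i \<noteq> ({v, nbr v i} \<in> P))" for v
    by (simp add: flip_def)
  have orB: "is_orientation (flip A P)"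
    using orA by (simp add: is_orientation_def flip_def nbr_edge_eq)
  show ?thesis
  proof
    assume "uso (flip A P)"
    have "{u, nbr u i} \<in> P \<longleftrightarrow> {v, nbr v i} \<in> P" if uv: "in_direct_phase A i u v" for u v
    proof -
      from uv have "u \<noteq> v" by (auto simp: in_direct_phase_def)
      with \<open>uso (flip A P)\<close> obtain j where j: "u j \<noteq> v j" "flip A P u j = flip A P v j"
        by (auto simp: uso_iff)
      obtain k where k: "u k \<noteq> v k" "A u k = A v k" using SW \<open>u \<noteq> v\<close> by blast
      have "j = i" using j uv other unfolding in_direct_phase_def by metis
      moreover have "k = i" using k uv unfolding in_direct_phase_def by metis
      ultimately show ?thesis using j k same by metis
    qed
    then show "\<forall>u v. in_direct_phase A i u v \<longrightarrow> ({u, nbr u i} \<in> P \<longleftrightarrow> {v, nbr v i} \<in> P)"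
      by blast
  next
    assume *: "\<forall>u v. in_direct_phase A i u v \<longrightarrow> ({u, nbr u i} \<in> P \<longleftrightarrow> {v, nbr v i} \<in> P)"
    have "\<exists>j. u j \<noteq> v j \<and> flip A P u j = flip A P v j" if uv: "u \<noteq> v" for u v
    proof -
      obtain k where k: "u k \<noteq> v k" "A u k = A v k" using SW uv by blast
      show ?thesis
      proof (cases "in_direct_phase A i u v")
        case True
        then have "k = i" using k unfolding in_direct_phase_def by metis
        then show ?thesis using k True * same by metis
      next
        case False
        show ?thesis
        proof (cases "k = i")
          case True
          then show ?thesis using False k other unfolding in_direct_phase_def by metis
        next
          case False
          then show ?thesis using k other by metis
        qed
      qed
    qed
    then show "uso (flip A P)" using orB by (auto simp: uso_iff)
  qed
qed

lemma phase_partition_exists: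
  fixes A :: "'n::finite orientation"
  assumes "uso A"
  obtains PP where "phase_partition A i PP"
    and "\<And>P. P \<subseteq> edges i \<Longrightarrow> uso (flip A P) \<longleftrightarrow> (\<exists>C \<subseteq> PP. P = \<Union>C)"
proof -
  define r where "r = {(e, e'). e \<in> edges i \<and> e' \<in> edges i \<and>
    (\<forall>P \<subseteq> edges i. uso (flip A P) \<longrightarrow> (e \<in> P \<longleftrightarrow> e' \<in> P))}"
  define PP where "PP = edges i // r"
  have eq: "equiv (edges i) r"
    by (rule equivI) (auto simp: r_def refl_on_def sym_def trans_def)
  have part: "partition_on (edges i) PP"
    unfolding PP_def by (rule partition_on_quotient[OF eq])
  have sub: "e' \<in> P" if "P \<subseteq> edges i" "uso (flip A P)" "X \<in> PP" "e \<in> X" "e' \<in> X" "e \<in> P"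
    for P X e e'
  proof -
    have "(e, e') \<in> r" using that(3-5) eq quotient_eq_iff unfolding PP_def by fastforce
    then show ?thesis using that by (auto simp: r_def)
  qed
  have direct: "({u, nbr u i}, {v, nbr v i}) \<in> r" if "in_direct_phase A i u v" for u v
    using that uso_flip_iff[OF assms] by (auto simp: r_def edge_in_edges)
  have un: "uso (flip A (\<Union>C))" if "C \<subseteq> PP" for C
  proof -
    have sub: "\<Union>C \<subseteq> edges i" using that part by (auto simp: partition_on_def)
    have closed: "e' \<in> \<Union>C" if "(e, e') \<in> r" "e \<in> \<Union>C" for e e'
      using that in_quotient_imp_closed[OF eq] \<open>C \<subseteq> PP\<close> unfolding PP_def by blast
    have "e \<in> \<Union>C \<longleftrightarrow> e' \<in> \<Union>C" if "(e, e') \<in> r" for e e'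
      using closed[OF that] closed[of e' e] equivE[OF eq] symD[of r e e'] that by blast
    with direct show ?thesis unfolding uso_flip_iff[OF assms sub] by blast
  qed
  have char: "uso (flip A P) \<longleftrightarrow> (\<exists>C \<subseteq> PP. P = \<Union>C)" if P: "P \<subseteq> edges i" for P
  proof
    assume fl: "uso (flip A P)"
    have "P = \<Union>{X \<in> PP. X \<subseteq> P}"
    proof (intro equalityI subsetI)
      fix e assume "e \<in> P"
      then obtain X where "X \<in> PP" "e \<in> X" using P part by (auto simp: partition_on_def)
      then show "e \<in> \<Union>{X \<in> PP. X \<subseteq> P}" using sub[OF P fl] \<open>e \<in> P\<close> by blast
    qed auto
    moreover have "{X \<in> PP. X \<subseteq> P} \<subseteq> PP" by blast
    ultimately show "\<exists>C \<subseteq> PP. P = \<Union>C" by (intro exI conjI)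
  qed (use un in blast)
  have "phase_partition A i PP"
    unfolding phase_partition_def
  proof (intro conjI allI impI)
    show "flippable_partition A i PP" using part un by (auto simp: flippable_partition_def)
  next
    fix QQ assume Q: "flippable_partition A i QQ"
    then have QQ: "partition_on (edges i) QQ" by (simp add: flippable_partition_def)
    have "\<exists>Y\<in>QQ. X \<subseteq> Y" if X: "X \<in> PP" for X
    proof -
      obtain e where e: "e \<in> X" using X part unfolding partition_on_def by fastforce
      then obtain Y where Y: "Y \<in> QQ" "e \<in> Y"
        using X part QQ unfolding partition_on_def by blast
      have "uso (flip A Y)"
        using Q Y(1) unfolding flippable_partition_def by (auto dest: spec[of _ "{Y}"])
      moreover have "Y \<subseteq> edges i" using QQ Y by (auto simp: partition_on_def)
      ultimately have "X \<subseteq> Y" using sub[OF _ _ X e _ Y(2)] by (intro subsetI)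
      then show ?thesis using Y(1) by (intro bexI)
    qed
    then show "refines (edges i) PP QQ" using part QQ by (simp add: refines_def)
  qed
  then show ?thesis using char by (rule that)
qed

lemma phase_partition_unique:
  assumes "phase_partition A i PP" "phase_partition A i QQ"
  shows "PP = QQ"
  using assms by (intro refines_asym[of "edges i"]) (auto simp: phase_partition_def)

lemma phase_partition_ex1:
  fixes A :: "'n::finite orientation"
  assumes "uso A"
  shows "\<exists>!PP. phase_partition A i PP"
proof -
  obtain PP where "phase_partition A i PP"
    by (rule phase_partition_exists[OF assms])
  then show ?thesis by (rule ex1I) (rule phase_partition_unique[OF _ \<open>phase_partition A i PP\<close>])
qed

lemma phase_partition_phases:
  fixes A :: "'n::finite orientation"
  assumes "uso A"
  shows "phase_partition A i (phases A i)"
  unfolding phases_def by (rule theI'[OF phase_partition_ex1[OF assms]])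

(* Schurr's characterization of the phases *)
lemma uso_flip_iff_phases:
  fixes A :: "'n::finite orientation"
  assumes "uso A" "P \<subseteq> edges i"
  shows "uso (flip A P) \<longleftrightarrow> (\<exists>C \<subseteq> phases A i. P = \<Union>C)"
proof -
  obtain PP where PP: "phase_partition A i PP"
    and char: "\<And>P. P \<subseteq> edges i \<Longrightarrow> uso (flip A P) \<longleftrightarrow> (\<exists>C \<subseteq> PP. P = \<Union>C)"
    by (rule phase_partition_exists[OF assms(1)]) (rule that)
  have "phases A i = PP"
    by (rule phase_partition_unique[OF phase_partition_phases[OF assms(1)] PP])
  then show ?thesis using char[OF assms(2)] by simp
qed

end

theory Submission
  imports Defs
begin

text \<open>
  By the Szabo--Welzl condition, two vertices in direct \<open>h\<close>-phase have \<open>h\<close>-edges of the same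
  direction. Hence the partial swap either fixes both endpoints or replaces both by their
  \<open>h\<close>-neighbors, and so it carries the direct-phase relation on \<open>h\<close>-edges into itself. As the
  partial swap is an involution, the two relations agree, and so do the flippable sets of
  \<open>h\<close>-edges, which determine the phases.
\<close>

text \<open>Both ends of an \<open>h\<close>-edge carry the same direction, which the swap keeps, so
  the second swap undoes the first.\<close>

lemma partial_swap_involution:
  assumes "is_orientation A"
  shows "partial_swap (partial_swap A h) h = A"
  using assms by (auto simp: fun_eq_iff partial_swap_def orientation_nbr)

text \<open>Szabo-Welzl yields a differing coordinate with equal directions; direct phase rules out
  all but \<open>h\<close>.\<close>

lemma in_direct_phase_same_direction:
  fixes A :: "'n::finite orientation"
  assumes "uso A" "in_direct_phase A h u v"
  shows "A u h = A v h"
proof -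
  have "u \<noteq> v" using assms(2) by (auto simp: in_direct_phase_def)
  then obtain i where "u i \<noteq> v i" "A u i = A v i"
    using assms(1) by (auto simp: uso_iff)
  then show ?thesis using assms(2) unfolding in_direct_phase_def by metis
qed

lemma in_direct_phase_partial_swap:
  fixes A :: "'n::finite orientation"
  assumes "uso A" "in_direct_phase A h u v"
  obtains u' v' where "in_direct_phase (partial_swap A h) h u' v'"
    and "{u', nbr u' h} = {u, nbr u h}" "{v', nbr v' h} = {v, nbr v h}"
proof (cases "A u h")
  case True
  then have "A v h" using in_direct_phase_same_direction[OF assms] by simp
  \<comment> \<open>At \<open>nbr u h\<close> and \<open>nbr v h\<close> the swapped orientation
    reads \<open>A u\<close> and \<open>A v\<close>.\<close>
  with True have "in_direct_phase (partial_swap A h) h (nbr u h) (nbr v h)"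
    using assms(2) uso_orientation[OF assms(1)]
    by (auto simp: in_direct_phase_def partial_swap_def orientation_nbr)
  then show ?thesis by (rule that) auto
next
  case False
  then have "\<not> A v h" using in_direct_phase_same_direction[OF assms] by simp
  with False have "in_direct_phase (partial_swap A h) h u v"
    using assms(2) by (simp add: in_direct_phase_def partial_swap_def)
  then show ?thesis by (rule that) auto
qed

lemma uso_flip_of_partial_swap:
  fixes A :: "'n::finite orientation"
  assumes "uso A" "P \<subseteq> edges h" "uso (flip (partial_swap A h) P)"
  shows "uso (flip A P)"
  unfolding uso_flip_iff[OF assms(1,2)]
proof (intro allI impI)
  fix u v assume "in_direct_phase A h u v"
  with assms(1) obtain u' v' where "in_direct_phase (partial_swap A h) h u' v'"
    and "{u', nbr u' h} = {u, nbr u h}" "{v', nbr v' h} = {v, nbr v h}"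
    by (rule in_direct_phase_partial_swap)
  then show "{u, nbr u h} \<in> P \<longleftrightarrow> {v, nbr v h} \<in> P"
    using assms(3) unfolding uso_flip_iff[OF uso_partial_swap[OF assms(1)] assms(2)] by metis
qed

lemma uso_flip_partial_swap_iff:
  fixes A :: "'n::finite orientation"
  assumes "uso A" "P \<subseteq> edges h"
  shows "uso (flip (partial_swap A h) P) \<longleftrightarrow> uso (flip A P)"
  \<comment> \<open>The converse applies the same lemma to \<open>partial_swap A h\<close>, whose
    own swap is \<open>A\<close>.\<close>
  using uso_flip_of_partial_swap[OF assms]
    uso_flip_of_partial_swap[OF uso_partial_swap[OF assms(1)] assms(2)]
    partial_swap_involution[OF uso_orientation[OF assms(1)]]
  by metis

text \<open>Phases see the orientation only through which unions of blocks, all subsets of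
  \<open>edges i\<close>, can be flipped.\<close>

lemma phases_cong:
  assumes "\<And>P. P \<subseteq> edges i \<Longrightarrow> uso (flip A P) \<longleftrightarrow> uso (flip B P)"
  shows "phases A i = phases B i"
proof -
  have "flippable_partition A i PP \<longleftrightarrow> flippable_partition B i PP" for PP
  proof -
    have "uso (flip A (\<Union>C)) \<longleftrightarrow> uso (flip B (\<Union>C))"
      if "partition_on (edges i) PP" "C \<subseteq> PP" for C
      using that by (intro assms) (auto simp: partition_on_def)
    then show ?thesis unfolding flippable_partition_def by blast
  qed
  then show ?thesis by (simp add: phases_def phase_partition_def)
qed

theorem lemma27:
  fixes K :: "'n::finite orientation" and h :: 'n
  assumes "uso K"
  shows "phases (partial_swap K h) h = phases K h"
  by (rule phases_cong) (rule uso_flip_partial_swap_iff[OF assms])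

end
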